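(* Let $n\ge 0$ be an integer. For every integer $k$ with $0\le k\le n$, the number of lattice paths from $(0,0)$ to $(n,n)$ with steps $(0,1)$ and $(1,0)$ that have exactly $2k$ steps above the line $x=y$ is independent of $k$; in fact, it is equal to the $n$th Catalan number $C_n$.
   Context: The $n$th Catalan number is $C_n=\frac{1}{n+1}\binom{2n}{n}$. A lattice path with steps $(0,1)$ and $(1,0)$ is a sequence of lattice points in which each consecutive difference is $(0,1)$ or $(1,0)$; it meets the line $x=y$ only at lattice points, so each step lies (apart from possibly one endpoint) strictly on one side of this line. A step is above the line $x=y$ if it lies in the region $y\ge x$, i.e. both of its endpoints satisfy $y\ge x$. *)

theory Defs
  imports Complex_Main "HOL-Library.Product_Plus"
begin

definition catalan :: "nat \<Rightarrow> real" where
  "catalan n = 1 / (real n + 1) * real ((2 * n) choose n)"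

(* A path is the list of lattice points it visits, endpoints included;
   its i-th step runs from p ! i to p ! Suc i. *)
definition lattice_path :: "(int \<times> int) list \<Rightarrow> bool" where
  "lattice_path p \<longleftrightarrow> p \<noteq> [] \<and>
     (\<forall>i. Suc i < length p \<longrightarrow> p ! Suc i - p ! i \<in> {(0, 1), (1, 0)})"

definition lattice_paths_between :: "int \<times> int \<Rightarrow> int \<times> int \<Rightarrow> (int \<times> int) list set" where
  "lattice_paths_between a b = {p. lattice_path p \<and> hd p = a \<and> last p = b}"

definition weakly_above_diagonal :: "int \<times> int \<Rightarrow> bool" where
  "weakly_above_diagonal z \<longleftrightarrow> snd z \<ge> fst z"

definition num_steps_above :: "(int \<times> int) list \<Rightarrow> nat" where
  "num_steps_above p = card {i. Suc i < length p \<and>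
     weakly_above_diagonal (p ! i) \<and> weakly_above_diagonal (p ! Suc i)}"

end

(* Encode a path by its word of steps. A balanced word having a step above the line splits uniquely
   as A U B D C, where U B D is its first excursion above the line; here A is balanced and stays
   weakly below, B is balanced and stays weakly above. Sending it to B D A U C, where D A U is now
   the first excursion below, is a bijection onto the balanced words having a step below, and it
   lowers the number of steps above by exactly 2. Hence the n + 1 classes k = 0, ..., n have equal
   size; since the number of steps above is always even, they partition the (2n choose n) balanced
   words. *)
theory Submission
  imports Defs
begin

subsection \<open>Words of steps\<close>

text \<open>\<open>True\<close> encodes the step (0,1) and \<open>False\<close> the step (1,0), so
  height is the value of y - x and the line x = y is level 0.\<close>

definition step_height :: "bool \<Rightarrow> int" where
  "step_height b = (if b then 1 else - 1)"

definition height :: "bool list \<Rightarrow> int" where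
  "height w = sum_list (map step_height w)"

lemma step_height_simps [simp]: "step_height True = 1" "step_height False = - 1"
  by (simp_all add: step_height_def)

lemma height_simps [simp]:
  "height [] = 0"
  "height (b # w) = step_height b + height w"
  "height (u @ v) = height u + height v"
  by (simp_all add: height_def)

text \<open>The starting height is a parameter because the factors of a word need not start on the
  line.\<close>

fun steps_above_from :: "int \<Rightarrow> bool list \<Rightarrow> nat" where
  "steps_above_from x [] = 0"
| "steps_above_from x (b # w) =
     (if 0 \<le> x \<and> 0 \<le> x + step_height b then 1 else 0) + steps_above_from (x + step_height b) w"

lemma steps_above_from_append [simp]:
  "steps_above_from x (u @ v) = steps_above_from x u + steps_above_from (x + height u) v"
  by (induction u arbitrary: x) (simp_all add: algebra_simps)

lemma steps_above_from_le_length: "steps_above_from x w \<le> length w"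
  by (induction w arbitrary: x) (auto simp: le_SucI)

text \<open>Raising a path keeps every step above the line there. This later moves excursions
  between levels 0, 1 and - 1.\<close>

lemma steps_above_from_mono: "x \<le> y \<Longrightarrow> steps_above_from x w \<le> steps_above_from y w"
proof (induction w arbitrary: x y)
  case (Cons b w)
  have "steps_above_from (x + step_height b) w \<le> steps_above_from (y + step_height b) w"
    by (rule Cons.IH) (use Cons.prems in simp)
  then show ?case using Cons.prems by auto
qed simp

lemma height_ge_neg_length: "- int (length w) \<le> height w"
  by (induction w) (auto simp: step_height_def)

text \<open>A step above the line changes \<open>max 0\<close> of the height by one, a step below leaves it unchanged.\<close>

lemma even_steps_above_from:
  "even (int (steps_above_from x w) + max 0 x + max 0 (x + height w))"
proof (induction w arbitrary: x)
  case (Cons b w)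
  have "even (int (steps_above_from (x + step_height b) w) + max 0 (x + step_height b)
      + max 0 (x + step_height b + height w))"
    by (rule Cons.IH)
  then show ?case
    by (cases b) (auto simp: max_def add.assoc split: if_splits)
qed simp

subsection \<open>First excursions\<close>

text \<open>Heights change by one, so a path starting on or below the line can make its first step
  above only by going up from height 0.\<close>

lemma exists_first_step_above:
  "\<lbrakk>x \<le> 0; steps_above_from x w > 0\<rbrakk> \<Longrightarrow>
     \<exists>A v. w = A @ True # v \<and> x + height A = 0 \<and> steps_above_from x A = 0"
proof (induction w arbitrary: x)
  case (Cons b w)
  show ?case
  proof (cases "0 \<le> x \<and> 0 \<le> x + step_height b")
    case True
    then have "x = 0" "b" using Cons.prems by (auto simp: step_height_def split: if_splits)
    then show ?thesis by (intro exI[of _ "[]"] exI[of _ w]) simp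
  next
    case False
    then have "x + step_height b \<le> 0" "steps_above_from (x + step_height b) w > 0"
      using Cons.prems by (auto simp: step_height_def split: if_splits)
    from Cons.IH[OF this] obtain A v where
      "w = A @ True # v" "x + step_height b + height A = 0"
      "steps_above_from (x + step_height b) A = 0"
      by blast
    with False show ?thesis by (intro exI[of _ "b # A"] exI[of _ v]) auto
  qed
qed simp

text \<open>Dually, a count smaller than the length means that some step is below, and the first
  such step goes down from height 0.\<close>

lemma exists_first_step_below:
  "\<lbrakk>0 \<le> x; steps_above_from x w < length w\<rbrakk> \<Longrightarrow>
     \<exists>B v. w = B @ False # v \<and> x + height B = 0 \<and> steps_above_from x B = length B"
proof (induction w arbitrary: x)
  case (Cons b w)
  show ?case
  proof (cases "0 \<le> x + step_height b")
    case False
    then have "x = 0" "\<not> b" using Cons.prems by (auto simp: step_height_def split: if_splits)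
    then show ?thesis by (intro exI[of _ "[]"] exI[of _ w]) simp
  next
    case True
    moreover have "steps_above_from (x + step_height b) w < length w"
      using Cons.prems True by auto
    ultimately obtain B v where
      "w = B @ False # v" "x + step_height b + height B = 0"
      "steps_above_from (x + step_height b) B = length B"
      using Cons.IH by blast
    with True Cons.prems show ?thesis by (intro exI[of _ "b # B"] exI[of _ v]) auto
  qed
qed simp

text \<open>Of two such prefixes, a strictly longer one would contain the up step from height 0 that
  follows the shorter one, which is a step above.\<close>

lemma first_step_above_unique:
  "\<lbrakk>A @ True # v = A' @ True # v'; x + height A = 0; x + height A' = 0;
    steps_above_from x A = 0; steps_above_from x A' = 0\<rbrakk> \<Longrightarrow> A = A' \<and> v = v'"
proof (induction A arbitrary: A' x)
  case Nil
  then show ?case by (cases A') auto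
next
  case (Cons b A)
  show ?case
  proof (cases A')
    case Nil
    then show ?thesis using Cons.prems by auto
  next
    case (Cons c A'')
    then show ?thesis
      using Cons.prems Cons.IH[of A'' "x + step_height b"] by (auto simp: add.assoc split: if_splits)
  qed
qed

text \<open>The tail contributes at most its length, so a full count forces the first step to be
  above as well.\<close>

lemma steps_above_from_Cons_eq_length:
  "steps_above_from x (b # w) = length (b # w) \<longleftrightarrow>
     0 \<le> x \<and> 0 \<le> x + step_height b \<and> steps_above_from (x + step_height b) w = length w"
  using steps_above_from_le_length[of "x + step_height b" w] by auto

lemma first_step_below_unique:
  "\<lbrakk>B @ False # v = B' @ False # v'; x + height B = 0; x + height B' = 0;
    steps_above_from x B = length B; steps_above_from x B' = length B'\<rbrakk> \<Longrightarrow> B = B' \<and> v = v'"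
proof (induction B arbitrary: B' x)
  case Nil
  show ?case
  proof (cases B')
    case (Cons c B'')
    then show ?thesis
      using Nil.prems(1,2) Nil.prems(5)[unfolded Cons steps_above_from_Cons_eq_length] by auto
  qed (use Nil in auto)
next
  case (Cons b B)
  note B = Cons.prems(4)[unfolded steps_above_from_Cons_eq_length]
  show ?case
  proof (cases B')
    case Nil
    then show ?thesis using Cons.prems(1,3) B by auto
  next
    case (Cons c B'')
    then show ?thesis
      using Cons.prems(1-3) B Cons.prems(5)[unfolded Cons steps_above_from_Cons_eq_length]
        Cons.IH[of B'' "x + step_height b"] by (auto simp: add.assoc)
  qed
qed

text \<open>Reaching a positive height from a nonpositive one would require the step from 0 to 1,
  which is above.\<close>

lemma height_nonpos_if_no_steps_above:
  "\<lbrakk>x \<le> 0; steps_above_from x w = 0\<rbrakk> \<Longrightarrow> x + height w \<le> 0"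
proof (induction w arbitrary: x)
  case (Cons b w)
  then have "x + step_height b \<le> 0" "steps_above_from (x + step_height b) w = 0"
    by (auto simp: step_height_def split: if_splits)
  from Cons.IH[OF this] show ?case by simp
qed simp

lemma height_nonneg_if_all_steps_above:
  "\<lbrakk>0 \<le> x; steps_above_from x w = length w\<rbrakk> \<Longrightarrow> 0 \<le> x + height w"
proof (induction w arbitrary: x)
  case (Cons b w)
  show ?case
    using Cons.prems(2)[unfolded steps_above_from_Cons_eq_length] Cons.IH[of "x + step_height b"]
    by (simp add: add.assoc)
qed simp

subsection \<open>Exchanging the first excursions\<close>

definition balanced_words :: "nat \<Rightarrow> nat \<Rightarrow> bool list set" where
  "balanced_words m j = {w. length w = m \<and> height w = 0 \<and> steps_above_from 0 w = j}"

lemma finite_balanced_words: "finite (balanced_words m j)"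
  by (rule finite_subset[OF _ finite_lists_length_eq[of "UNIV :: bool set" m]])
    (auto simp: balanced_words_def)

text \<open>Writing the count as \<open>j + 2\<close> guarantees a step above and prepares for the
  exchange, which lowers it to \<open>j\<close>.\<close>

lemma balanced_words_first_above_decomposition:
  assumes "w \<in> balanced_words m (j + 2)"
  obtains A B C where "w = A @ True # B @ False # C" "height A = 0" "steps_above_from 0 A = 0"
    "height B = 0" "steps_above_from 0 B = length B" "height C = 0"
proof -
  from assms have w: "height w = 0" "steps_above_from 0 w > 0" by (auto simp: balanced_words_def)
  obtain A v where A: "w = A @ True # v" "height A = 0" "steps_above_from 0 A = 0"
    using exists_first_step_above[OF order_refl w(2)] by auto
  have v: "height v = - 1" using A w by simp
  \<comment> \<open>Inside \<open>w\<close> the word \<open>v\<close> starts at height 1. Reading it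
    from 0 raises the axis by one, so the first return of \<open>w\<close> to the line becomes the
    first step below.\<close>
  have "steps_above_from 0 v \<noteq> length v"
    using height_nonneg_if_all_steps_above[of 0 v] v by auto
  then have "steps_above_from 0 v < length v" using steps_above_from_le_length[of 0 v] by simp
  then obtain B C where B: "v = B @ False # C" "height B = 0" "steps_above_from 0 B = length B"
    using exists_first_step_below[of 0 v] by auto
  show thesis by (rule that[of A B C]) (use A B v in auto)
qed

text \<open>Mirror image of the previous decomposition; \<open>j < m\<close> guarantees a step
  below, and \<open>v\<close> is read with the axis lowered by one.\<close>

lemma balanced_words_first_below_decomposition:
  assumes "w \<in> balanced_words m j" "j < m"
  obtains A B C where "w = B @ False # A @ True # C" "height A = 0" "steps_above_from 0 A = 0"
    "height B = 0" "steps_above_from 0 B = length B" "height C = 0"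
proof -
  from assms have w: "height w = 0" "steps_above_from 0 w < length w"
    by (auto simp: balanced_words_def)
  obtain B v where B: "w = B @ False # v" "height B = 0" "steps_above_from 0 B = length B"
    using exists_first_step_below[OF order_refl w(2)] by auto
  have v: "height v = 1" using B w by simp
  have "steps_above_from 0 v > 0"
    using height_nonpos_if_no_steps_above[of 0 v] v by auto
  then obtain A C where A: "v = A @ True # C" "height A = 0" "steps_above_from 0 A = 0"
    using exists_first_step_above[of 0 v] by auto
  show thesis by (rule that[of B A C]) (use A B v in auto)
qed

lemma card_balanced_words_step:
  assumes "j < m"
  shows "card (balanced_words m (j + 2)) = card (balanced_words m j)"
proof -
  \<comment> \<open>Both classes are parametrized by the same triples. The last equation counts the
    steps above in \<open>g (A, B, C)\<close>; in \<open>f (A, B, C)\<close> the two steps enclosing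
    \<open>B\<close> add 2.\<close>
  define T where "T = {(A, B, C). height A = 0 \<and> steps_above_from 0 A = 0 \<and>
    height B = 0 \<and> steps_above_from 0 B = length B \<and> height C = 0 \<and>
    length A + length B + length C + 2 = m \<and> length B + steps_above_from 0 C = j}"
  define f where "f = (\<lambda>(A, B, C). A @ True # B @ False # C)"
  define g where "g = (\<lambda>(A, B, C). B @ False # A @ True # C)"
  \<comment> \<open>In \<open>f\<close> the factor \<open>B\<close> runs from height 1, and in
    \<open>g\<close> the factor \<open>A\<close> runs from height - 1, whereas \<open>T\<close>
    measures both from 0.\<close>
  have shift_up: "steps_above_from 1 B = length B" if "steps_above_from 0 B = length B" for B
    using that steps_above_from_mono[of 0 1 B] steps_above_from_le_length[of 1 B] by simp
  have shift_down: "steps_above_from (- 1) A = 0" if "steps_above_from 0 A = 0" for A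
    using that steps_above_from_mono[of "- 1" 0 A] by simp
  have "bij_betw f T (balanced_words m (j + 2))"
  proof (intro bij_betwI')
    fix s t assume "s \<in> T" "t \<in> T"
    then show "f s = f t \<longleftrightarrow> s = t"
      by (auto simp: T_def f_def dest!: first_step_above_unique[where x = 0]
          first_step_below_unique[where x = 0])
  next
    fix t assume "t \<in> T"
    then show "f t \<in> balanced_words m (j + 2)"
      by (auto simp: T_def f_def balanced_words_def shift_up)
  next
    fix w assume w: "w \<in> balanced_words m (j + 2)"
    then obtain A B C where "w = A @ True # B @ False # C" "height A = 0" "steps_above_from 0 A = 0"
      "height B = 0" "steps_above_from 0 B = length B" "height C = 0"
      by (rule balanced_words_first_above_decomposition)
    with w show "\<exists>t\<in>T. w = f t"
      by (intro bexI[of _ "(A, B, C)"]) (auto simp: T_def f_def balanced_words_def shift_up)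
  qed
  moreover have "bij_betw g T (balanced_words m j)"
  proof (intro bij_betwI')
    fix s t assume "s \<in> T" "t \<in> T"
    then show "g s = g t \<longleftrightarrow> s = t"
      by (auto simp: T_def g_def dest!: first_step_above_unique[where x = 0]
          first_step_below_unique[where x = 0])
  next
    fix t assume "t \<in> T"
    then show "g t \<in> balanced_words m j"
      by (auto simp: T_def g_def balanced_words_def shift_down)
  next
    fix w assume w: "w \<in> balanced_words m j"
    then obtain A B C where "w = B @ False # A @ True # C" "height A = 0" "steps_above_from 0 A = 0"
      "height B = 0" "steps_above_from 0 B = length B" "height C = 0"
      using assms by (rule balanced_words_first_below_decomposition)
    with w show "\<exists>t\<in>T. w = g t"
      by (intro bexI[of _ "(A, B, C)"]) (auto simp: T_def g_def balanced_words_def shift_down)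
  qed
  ultimately show ?thesis by (metis bij_betw_same_card)
qed

subsection \<open>Counting balanced words\<close>

text \<open>Here \<open>k\<close> is the number of letters \<open>True\<close>, giving height k - (m
  - k). Splitting by the first letter yields Pascal's rule.\<close>

lemma card_words_height:
  "card {w. length w = m \<and> height w = 2 * int k - int m} = m choose k"
proof (induction m arbitrary: k)
  case 0
  have "{w. length w = 0 \<and> height w = 2 * int k - int 0} = (if k = 0 then {[]} else {})" by auto
  then show ?case by (cases k) auto
next
  case (Suc m)
  define S where "S h = {w. length w = m \<and> height w = h}" for h
  have fin: "finite (S h)" for h
    by (rule finite_subset[OF _ finite_lists_length_eq[of "UNIV :: bool set" m]]) (auto simp: S_def)
  have "{w. length w = Suc m \<and> height w = 2 * int k - int (Suc m)} =
      Cons True ` S (2 * int k - 2 - int m) \<union> Cons False ` S (2 * int k - int m)"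
    by (auto simp: S_def length_Suc_conv step_height_def image_iff split: if_splits)
  moreover have "card \<dots> = card (S (2 * int k - 2 - int m)) + card (S (2 * int k - int m))"
    using fin by (subst card_Un_disjoint) (auto simp: card_image)
  moreover have "card (S (2 * int k - int m)) = m choose k"
    unfolding S_def by (rule Suc.IH)
  \<comment> \<open>For \<open>k = 0\<close> the required height is below the minimum - m; for
    \<open>k = Suc k'\<close> it equals 2 k' - m, as in the induction hypothesis.\<close>
  moreover have "card (S (2 * int k - 2 - int m)) = (case k of 0 \<Rightarrow> 0 | Suc k' \<Rightarrow> m choose k')"
  proof (cases k)
    case 0
    have "S (2 * int k - 2 - int m) = {}"
    proof -
      have False if "w \<in> S (2 * int k - 2 - int m)" for w
        using that 0 height_ge_neg_length[of w] by (simp add: S_def)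
      then show ?thesis by blast
    qed
    then show ?thesis using 0 by simp
  next
    case (Suc k')
    then show ?thesis using Suc.IH[of k'] by (simp add: S_def)
  qed
  ultimately show ?case by (cases k) auto
qed

lemma card_balanced_words:
  assumes "k \<le> n"
  shows "(n + 1) * card (balanced_words (2 * n) (2 * k)) = (2 * n) choose n"
proof -
  have const: "card (balanced_words (2 * n) (2 * i)) = card (balanced_words (2 * n) 0)"
    if "i \<le> n" for i
    using that
  proof (induction i)
    case (Suc i)
    then show ?case using card_balanced_words_step[of "2 * i" "2 * n"] by simp
  qed simp
  \<comment> \<open>The height \<open>2 * int n - int (2 * n)\<close> is 0, written to match the
    counting lemma with \<open>k = n\<close>.\<close>
  have "{w. length w = 2 * n \<and> height w = 2 * int n - int (2 * n)} =
      (\<Union>i\<in>{..n}. balanced_words (2 * n) (2 * i))"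
  proof (intro equalityI subsetI)
    fix w assume w: "w \<in> {w. length w = 2 * n \<and> height w = 2 * int n - int (2 * n)}"
    \<comment> \<open>Both ends are at height 0, so the two \<open>max\<close> terms in the parity
      lemma vanish.\<close>
    then have "even (steps_above_from 0 w)"
      using even_steps_above_from[of 0 w] by simp
    then obtain i where "steps_above_from 0 w = 2 * i" by (elim evenE)
    with w steps_above_from_le_length[of 0 w]
    show "w \<in> (\<Union>i\<in>{..n}. balanced_words (2 * n) (2 * i))"
      by (auto simp: balanced_words_def)
  qed (auto simp: balanced_words_def)
  then have "(2 * n) choose n = card (\<Union>i\<in>{..n}. balanced_words (2 * n) (2 * i))"
    using card_words_height[of "2 * n" n] by simp
  also have "\<dots> = (\<Sum>i\<le>n. card (balanced_words (2 * n) (2 * i)))"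
    by (rule card_UN_disjoint) (auto simp: finite_balanced_words, auto simp: balanced_words_def)
  also have "\<dots> = (n + 1) * card (balanced_words (2 * n) (2 * k))"
    using const assms by simp
  finally show ?thesis by simp
qed

subsection \<open>Lattice paths as words\<close>

fun path_of_word :: "int \<times> int \<Rightarrow> bool list \<Rightarrow> (int \<times> int) list" where
  "path_of_word z [] = [z]"
| "path_of_word z (b # w) = z # path_of_word (z + (if b then (0, 1) else (1, 0))) w"

lemma path_of_word_neq_Nil [simp]: "path_of_word z w \<noteq> []" "[] \<noteq> path_of_word z w"
  by (cases w; simp)+

lemma hd_path_of_word [simp]: "hd (path_of_word z w) = z"
  by (cases w) auto

lemma path_of_word_Cons_hd: "path_of_word z w = z # tl (path_of_word z w)"
  by (cases w) auto

text \<open>Together with the sum of the coordinates, this difference determines the endpoint: from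
  the origin, ending at (n,n) amounts to height 0 and length 2n.\<close>

lemma last_path_of_word_diff:
  "snd (last (path_of_word z w)) - fst (last (path_of_word z w)) = snd z - fst z + height w"
  by (induction w arbitrary: z) (auto simp: step_height_def)

lemma last_path_of_word_sum:
  "snd (last (path_of_word z w)) + fst (last (path_of_word z w)) = snd z + fst z + int (length w)"
  by (induction w arbitrary: z) auto

lemma path_of_word_inj: "path_of_word z v = path_of_word z w \<Longrightarrow> v = w"
proof (induction v arbitrary: z w)
  case Nil
  then show ?case by (cases w) auto
next
  case (Cons b v)
  then obtain c w' where w: "w = c # w'" by (cases w) auto
  have tails: "path_of_word (z + (if b then (0, 1) else (1, 0))) v =
      path_of_word (z + (if c then (0, 1) else (1, 0))) w'"
    using Cons.prems w by simp
  \<comment> \<open>The second point of the path, the head of the tail, reveals the first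
    letter.\<close>
  then have "z + (if b then (0, 1) else (1, 0)) = z + (if c then (0, 1) else (1, 0))"
    by (metis hd_path_of_word)
  then have "b = c" by (auto split: if_splits)
  with tails Cons.IH w show ?case by auto
qed

lemma lattice_path_singleton [simp]: "lattice_path [z]"
  by (simp add: lattice_path_def)

text \<open>Separating index 0 from the successors turns the indexed definition into a recursion
  that fits \<open>path_of_word\<close>.\<close>

lemma lattice_path_Cons_Cons [simp]:
  "lattice_path (z # y # p) \<longleftrightarrow> y - z \<in> {(0, 1), (1, 0)} \<and> lattice_path (y # p)"
proof -
  have "(\<forall>i. Suc i < length (z # y # p) \<longrightarrow> (z # y # p) ! Suc i - (z # y # p) ! i \<in> S) \<longleftrightarrow>
    y - z \<in> S \<and> (\<forall>i. Suc i < length (y # p) \<longrightarrow> (y # p) ! Suc i - (y # p) ! i \<in> S)"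
    (is "(\<forall>i. ?P i) \<longleftrightarrow> _") for S
  proof -
    have "(\<forall>i. ?P i) \<longleftrightarrow> ?P 0 \<and> (\<forall>i. ?P (Suc i))"
      by (metis not0_implies_Suc)
    then show ?thesis by simp
  qed
  then show ?thesis by (simp only: lattice_path_def) simp
qed

lemma lattice_path_path_of_word: "lattice_path (path_of_word z w)"
proof (induction w arbitrary: z)
  case (Cons b w)
  define y where "y = z + (if b then (0, 1) else (1, 0))"
  obtain p where p: "path_of_word y w = y # p" using path_of_word_Cons_hd by blast
  have "y - z \<in> {(0, 1), (1, 0)}" by (simp add: y_def)
  then have "lattice_path (z # y # p)" using Cons.IH[of y] p by simp
  then show ?case by (simp add: y_def[symmetric] p)
qed simp

text \<open>Surjectivity of the encoding: each difference of consecutive points dictates one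
  letter.\<close>

lemma lattice_path_eq_path_of_word: "lattice_path (z # p) \<Longrightarrow> \<exists>w. z # p = path_of_word z w"
proof (induction p arbitrary: z)
  case Nil
  show ?case by (rule exI[of _ "[]"]) simp
next
  case (Cons y p)
  then obtain w where w: "y # p = path_of_word y w"
    by (meson lattice_path_Cons_Cons)
  from Cons.prems have "y - z = (0, 1) \<or> y - z = (1, 0)" by simp
  then obtain b where "y = z + (if b then (0, 1) else (1, 0))"
    by (metis add.commute diff_add_cancel)
  with w show ?case by (intro exI[of _ "b # w"]) simp
qed

lemma num_steps_above_Cons_Cons:
  "num_steps_above (z # y # p) =
     (if weakly_above_diagonal z \<and> weakly_above_diagonal y then 1 else 0) + num_steps_above (y # p)"
proof -
  let ?S = "\<lambda>p. {i. Suc i < length p \<and>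
     weakly_above_diagonal (p ! i) \<and> weakly_above_diagonal (p ! Suc i)}"
  have fin: "finite (?S q)" for q
    by (rule finite_subset[of _ "{..<length q}"]) auto
  \<comment> \<open>Index 0 is the new first step; every step of the remaining path has its index
    shifted by one.\<close>
  have "?S (z # y # p) =
      (if weakly_above_diagonal z \<and> weakly_above_diagonal y then {0} else {}) \<union> Suc ` ?S (y # p)"
    (is "_ = ?Z \<union> _")
  proof (rule set_eqI)
    fix i show "i \<in> ?S (z # y # p) \<longleftrightarrow> i \<in> ?Z \<union> Suc ` ?S (y # p)"
      by (cases i) auto
  qed
  moreover have "card (?Z \<union> Suc ` ?S (y # p)) = card ?Z + card (?S (y # p))"
    using fin[of "y # p"] by (subst card_Un_disjoint) (auto simp: card_image)
  ultimately show ?thesis by (simp add: num_steps_above_def)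
qed

lemma num_steps_above_path_of_word:
  "num_steps_above (path_of_word z w) = steps_above_from (snd z - fst z) w"
proof (induction w arbitrary: z)
  case Nil
  show ?case by (simp add: num_steps_above_def)
next
  case (Cons b w)
  define y where "y = z + (if b then (0, 1) else (1, 0))"
  obtain p where p: "path_of_word y w = y # p" using path_of_word_Cons_hd by blast
  have y: "snd y - fst y = snd z - fst z + step_height b" by (simp add: y_def)
  have "num_steps_above (path_of_word z (b # w)) =
      (if weakly_above_diagonal z \<and> weakly_above_diagonal y then 1 else 0)
      + num_steps_above (path_of_word y w)"
    by (simp add: y_def[symmetric] p num_steps_above_Cons_Cons)
  also have "num_steps_above (path_of_word y w) =
      steps_above_from (snd z - fst z + step_height b) w"
    by (simp only: Cons.IH y)
  also have "weakly_above_diagonal y \<longleftrightarrow> 0 \<le> snd z - fst z + step_height b"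
    using y by (auto simp: weakly_above_diagonal_def)
  finally show ?case by (simp add: weakly_above_diagonal_def)
qed

lemma bij_betw_path_of_word:
  "bij_betw (path_of_word (0, 0)) (balanced_words (2 * n) j)
     {p \<in> lattice_paths_between (0, 0) (int n, int n). num_steps_above p = j}"
proof (intro bij_betwI')
  fix v w show "path_of_word (0, 0) v = path_of_word (0, 0) w \<longleftrightarrow> v = w"
    using path_of_word_inj by blast
next
  fix w assume w: "w \<in> balanced_words (2 * n) j"
  then have "last (path_of_word (0, 0) w) = (int n, int n)"
    using last_path_of_word_diff[of "(0, 0)" w] last_path_of_word_sum[of "(0, 0)" w]
    by (simp add: balanced_words_def prod_eq_iff)
  with w show "path_of_word (0, 0) w \<in>
      {p \<in> lattice_paths_between (0, 0) (int n, int n). num_steps_above p = j}"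
    by (simp add: lattice_paths_between_def balanced_words_def lattice_path_path_of_word
        num_steps_above_path_of_word)
next
  fix p assume p: "p \<in> {p \<in> lattice_paths_between (0, 0) (int n, int n). num_steps_above p = j}"
  then obtain q where "p = (0, 0) # q"
    by (cases p) (auto simp: lattice_paths_between_def lattice_path_def)
  with p obtain w where w: "p = path_of_word (0, 0) w"
    using lattice_path_eq_path_of_word[of "(0, 0)" q] by (auto simp: lattice_paths_between_def)
  have "w \<in> balanced_words (2 * n) j"
    using p last_path_of_word_diff[of "(0, 0)" w] last_path_of_word_sum[of "(0, 0)" w]
    by (simp add: w balanced_words_def lattice_paths_between_def num_steps_above_path_of_word)
  with w show "\<exists>w\<in>balanced_words (2 * n) j. p = path_of_word (0, 0) w" by blast
qed

theorem mainTheorem1: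
  fixes n :: nat
  shows "\<forall>k::nat. k \<le> n \<longrightarrow>
    real (card {p \<in> lattice_paths_between (0, 0) (int n, int n). num_steps_above p = 2 * k}) = catalan n"
proof (intro allI impI)
  fix k :: nat assume "k \<le> n"
  then have "(real n + 1) * real (card (balanced_words (2 * n) (2 * k))) = real ((2 * n) choose n)"
    using card_balanced_words[of k n] by (metis of_nat_1 of_nat_add of_nat_mult)
  then have "real (card (balanced_words (2 * n) (2 * k))) = catalan n"
    by (simp add: catalan_def field_simps)
  then show "real (card {p \<in> lattice_paths_between (0, 0) (int n, int n).
      num_steps_above p = 2 * k}) = catalan n"
    by (simp add: bij_betw_same_card[OF bij_betw_path_of_word, symmetric])
qed

end
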